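(* Let $P,G\in\mathbb{R}_{>0}^{m\times n}$ and let $f:\mathbb{R}_{>0}^m\to\mathbb{R}_{>0}$ be monotone and homogeneous. Let $\mathbf{w}\in\mathbb{R}_{>0}^m$ be a parameter vector whose proportional allocation (with transformation matrix $G$) has objective value $\gamma=f(\ell(P,G,\mathbf{w}))$. Let $\tilde{\mathbf{w}}\in\mathbb{R}_{>0}^m$ be $\eta$-approximate to $\mathbf{w}$ for some $\eta>1$. Then the proportional allocation for $\tilde{\mathbf{w}}$ (with the same $G$) has objective value at least $\gamma/\eta$ if $f$ is to be maximized, and at most $\eta\gamma$ if $f$ is to be minimized; that is, $f(\ell(P,G,\tilde{\mathbf{w}}))\ge\gamma/\eta$ and $f(\ell(P,G,\tilde{\mathbf{w}}))\le\eta\gamma$, respectively.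
   Context: For $P=(p_{i,j}),G=(g_{i,j})\in\mathbb{R}_{>0}^{m\times n}$ and $\mathbf{w}\in\mathbb{R}_{>0}^m$, the proportional allocation is $x_{i,j}(G,\mathbf{w})=\dfrac{g_{i,j}w_i}{\sum_{i'=1}^m g_{i',j}w_{i'}}$ and the load of agent $i$ is $\ell_i(P,G,\mathbf{w})=\sum_{j=1}^n p_{i,j}\,x_{i,j}(G,\mathbf{w})$; $\ell(P,G,\mathbf{w})$ is the vector of loads. An exponentiated proportional (EP) allocation is the case $g_{i,j}=p_{i,j}^\alpha$ for a fixed $\alpha\in\mathbb{R}$. A vector $\tilde{\mathbf{w}}$ is $\eta$-approximate to $\mathbf{w}$ if $\frac{\tilde w_{i'}}{\tilde w_i}\le\eta\cdot\frac{w_{i'}}{w_i}$ for all $i,i'\in[m]$. $f$ is monotone if $\ell_i\ge\ell'_i$ for all $i$ implies $f(\ell)\ge f(\ell')$; $f$ is homogeneous if $f(c\,\ell)=c\,f(\ell)$ for all $c>0$. *)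

theory Defs
  imports "HOL-Analysis.Analysis"
begin

text \<open>
  Agents are indexed by \<open>'m\<close> and items by \<open>'n\<close>, so that an \<open>m \<times> n\<close> matrix has type
  \<open>real ^ 'n ^ 'm\<close> and \<open>P $ i $ j\<close> is its entry for agent \<open>i\<close> and item \<open>j\<close>.
\<close>

definition pos_vecs :: "(real ^ 'm) set" where
  "pos_vecs = {v. \<forall>i. 0 < v $ i}"

definition pos_mats :: "(real ^ 'n ^ 'm) set" where
  "pos_mats = {A. \<forall>i j. 0 < A $ i $ j}"

definition prop_alloc :: "real ^ 'n ^ 'm \<Rightarrow> real ^ 'm \<Rightarrow> real ^ 'n ^ 'm" where
  "prop_alloc G w = (\<chi> i j. G $ i $ j * w $ i / (\<Sum>i'\<in>UNIV. G $ i' $ j * w $ i'))"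

definition loads :: "real ^ 'n ^ 'm \<Rightarrow> real ^ 'n ^ 'm \<Rightarrow> real ^ 'm \<Rightarrow> real ^ 'm" where
  "loads P G w = (\<chi> i. \<Sum>j\<in>UNIV. P $ i $ j * prop_alloc G w $ i $ j)"

text \<open>\<open>approximate_to \<eta> w' w\<close>: the vector \<open>w'\<close> is \<open>\<eta>\<close>-approximate to \<open>w\<close>.\<close>

definition approximate_to :: "real \<Rightarrow> real ^ 'm \<Rightarrow> real ^ 'm \<Rightarrow> bool" where
  "approximate_to \<eta> w' w \<longleftrightarrow> (\<forall>i i'. w' $ i' / w' $ i \<le> \<eta> * (w $ i' / w $ i))"

text \<open>
  Objectives are functions on the open positive orthant only; their values elsewhere are
  unconstrained. In \<^const>\<open>mono_on\<close>, the order on vectors is the componentwise one.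
\<close>

definition monotone_objective :: "(real ^ 'm \<Rightarrow> real) \<Rightarrow> bool" where
  "monotone_objective f \<longleftrightarrow> mono_on pos_vecs f"

definition homogeneous_objective :: "(real ^ 'm \<Rightarrow> real) \<Rightarrow> bool" where
  "homogeneous_objective f \<longleftrightarrow> (\<forall>l\<in>pos_vecs. \<forall>c>0. f (c *\<^sub>R l) = c * f l)"

end

theory Submission
  imports Defs
begin

text \<open>The reciprocal of a share, \<open>1 / x_ij(w)\<close>, is the sum over k of
  \<open>g_kj * w_k / (g_ij * w_i)\<close>: a positive combination of the ratios
  \<open>w_k / w_i\<close>, which are exactly what \<open>approximate_to\<close> controls. Hence
  every single share changes by at most a factor \<eta> (\<open>prop_alloc_approx\<close>), and so
  does every load, being a nonnegative combination of shares (\<open>loads_approx\<close>).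
  Monotonicity carries this componentwise bound over to f, and homogeneity pulls the factor out
  (\<open>objective_approx\<close>). Since the approximation relation is symmetric
  (\<open>approximate_to_sym\<close>), the bound holds in both directions, one for each half of the
  conclusion.\<close>

lemma approximate_to_sym:
  assumes "w \<in> pos_vecs" and "w' \<in> pos_vecs" and "approximate_to \<eta> w' w"
  shows "approximate_to \<eta> w w'"
  unfolding approximate_to_def
proof (intro allI)
  fix i i'
  have pos: "0 < w $ i" "0 < w $ i'" "0 < w' $ i" "0 < w' $ i'"
    using assms(1,2) by (auto simp: pos_vecs_def)
  \<comment> \<open>The hypothesis is taken with the two indices exchanged; passing to reciprocals
    then moves \<eta> to the other side.\<close>
  have "w' $ i / w' $ i' \<le> \<eta> * (w $ i / w $ i')"
    using assms(3) by (simp add: approximate_to_def)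
  then show "w $ i' / w $ i \<le> \<eta> * (w' $ i' / w' $ i)"
    using pos by (simp add: field_simps)
qed

lemma sum_pos_mats:
  assumes "G \<in> pos_mats" and "w \<in> pos_vecs"
  shows "0 < (\<Sum>i\<in>UNIV. G $ i $ j * w $ i)"
  using assms by (intro sum_pos) (auto simp: pos_mats_def pos_vecs_def)

text \<open>With i fixed, the ratio bounds against all agents k are averaged with the weights
  \<open>G $ k $ j\<close>, which compares the two normalizing sums of item j.\<close>

lemma prop_alloc_approx:
  assumes G: "G \<in> pos_mats" and w: "w \<in> pos_vecs" and w': "w' \<in> pos_vecs"
    and approx: "approximate_to \<eta> w' w"
  shows "prop_alloc G w $ i $ j \<le> \<eta> * prop_alloc G w' $ i $ j"
proof -
  define S where "S v = (\<Sum>k\<in>UNIV. G $ k $ j * v $ k)" for v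
  have pos: "0 < G $ k $ j" "0 < w $ k" "0 < w' $ k" for k
    using G w w' by (auto simp: pos_mats_def pos_vecs_def)
  have S: "0 < S w" "0 < S w'"
    unfolding S_def using G w w' by (auto intro: sum_pos_mats)
  \<comment> \<open>Cleared of denominators, the bound is linear in the entries with index k, so
    summing over k produces \<open>S w'\<close> and \<open>S w\<close>.\<close>
  have "w' $ k * w $ i \<le> \<eta> * (w $ k * w' $ i)" for k
  proof -
    have "w' $ k / w' $ i \<le> \<eta> * (w $ k / w $ i)"
      using approx by (simp add: approximate_to_def)
    then show ?thesis
      using pos(2)[of i] pos(3)[of i] by (simp add: field_simps)
  qed
  then have "G $ k $ j * (w' $ k * w $ i) \<le> G $ k $ j * (\<eta> * (w $ k * w' $ i))" for k
    using pos(1) by (intro mult_left_mono) (auto intro: less_imp_le)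
  then have "(\<Sum>k\<in>UNIV. G $ k $ j * (w' $ k * w $ i))
      \<le> (\<Sum>k\<in>UNIV. G $ k $ j * (\<eta> * (w $ k * w' $ i)))"
    by (intro sum_mono)
  then have "S w' * w $ i \<le> \<eta> * (S w * w' $ i)"
    by (simp add: S_def sum_distrib_left sum_distrib_right mult_ac)
  then have "G $ i $ j * (S w' * w $ i) \<le> G $ i $ j * (\<eta> * (S w * w' $ i))"
    using pos(1) by (intro mult_left_mono) (auto intro: less_imp_le)
  then have "G $ i $ j * w $ i / S w \<le> \<eta> * (G $ i $ j * w' $ i / S w')"
    using S by (simp add: field_simps)
  then show ?thesis
    by (simp add: prop_alloc_def S_def)
qed

lemma loads_approx:
  assumes P: "P \<in> pos_mats" and "G \<in> pos_mats" and "w \<in> pos_vecs" and "w' \<in> pos_vecs"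
    and "approximate_to \<eta> w' w"
  shows "loads P G w \<le> \<eta> *\<^sub>R loads P G w'"
  unfolding less_eq_vec_def
proof
  fix i
  have "P $ i $ j * prop_alloc G w $ i $ j \<le> P $ i $ j * (\<eta> * prop_alloc G w' $ i $ j)" for j
    using P prop_alloc_approx[OF assms(2-5)]
    by (intro mult_left_mono) (auto simp: pos_mats_def intro: less_imp_le)
  then have "(\<Sum>j\<in>UNIV. P $ i $ j * prop_alloc G w $ i $ j)
      \<le> (\<Sum>j\<in>UNIV. P $ i $ j * (\<eta> * prop_alloc G w' $ i $ j))"
    by (intro sum_mono)
  then show "loads P G w $ i \<le> (\<eta> *\<^sub>R loads P G w') $ i"
    by (simp add: loads_def sum_distrib_left mult_ac)
qed

text \<open>Objectives are constrained only on the positive orthant, so the load vectors must be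
  shown to lie there before monotonicity or homogeneity applies.\<close>

lemma loads_pos:
  assumes "P \<in> pos_mats" and "G \<in> pos_mats" and "w \<in> pos_vecs"
  shows "loads P G w \<in> pos_vecs"
proof -
  have "0 < P $ i $ j * prop_alloc G w $ i $ j" for i j
    using assms sum_pos_mats[OF assms(2,3), of j]
    by (simp add: prop_alloc_def pos_mats_def pos_vecs_def)
  then show ?thesis
    by (auto simp: loads_def pos_vecs_def intro: sum_pos)
qed

text \<open>Kept one-sided so that it can be used twice, the second time with \<open>w\<close> and
  \<open>w'\<close> exchanged.\<close>

lemma objective_approx:
  assumes "P \<in> pos_mats" and "G \<in> pos_mats"
    and mono: "monotone_objective f" and hom: "homogeneous_objective f"
    and "w \<in> pos_vecs" and "w' \<in> pos_vecs" and "0 < \<eta>" and "approximate_to \<eta> w' w"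
  shows "f (loads P G w) \<le> \<eta> * f (loads P G w')"
proof -
  have pos: "loads P G w \<in> pos_vecs" "loads P G w' \<in> pos_vecs"
    using assms by (auto intro: loads_pos)
  \<comment> \<open>\<open>mono_on\<close> needs both compared points in the orthant, including the
    scaled one.\<close>
  then have "\<eta> *\<^sub>R loads P G w' \<in> pos_vecs"
    using \<open>0 < \<eta>\<close> by (simp add: pos_vecs_def)
  then have "f (loads P G w) \<le> f (\<eta> *\<^sub>R loads P G w')"
    using mono pos loads_approx[OF assms(1,2,5,6,8)]
    unfolding monotone_objective_def by (auto dest: mono_onD)
  also have "\<dots> = \<eta> * f (loads P G w')"
    using hom pos \<open>0 < \<eta>\<close> by (simp add: homogeneous_objective_def)
  finally show ?thesis .
qed

theorem theorem7p2:
  fixes P G :: "real ^ 'n ^ 'm"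
    and f :: "real ^ 'm \<Rightarrow> real"
    and w w' :: "real ^ 'm"
    and \<gamma> \<eta> :: real
  assumes "P \<in> pos_mats" and "G \<in> pos_mats"
    and "f \<in> pos_vecs \<rightarrow> {0<..}"
    and "monotone_objective f" and "homogeneous_objective f"
    and "w \<in> pos_vecs" and "\<gamma> = f (loads P G w)"
    and "w' \<in> pos_vecs" and "\<eta> > 1" and "approximate_to \<eta> w' w"
  shows "f (loads P G w') \<ge> \<gamma> / \<eta> \<and> f (loads P G w') \<le> \<eta> * \<gamma>"
proof -
  have "0 < \<eta>"
    using \<open>\<eta> > 1\<close> by simp
  have "\<gamma> \<le> \<eta> * f (loads P G w')"
    unfolding \<open>\<gamma> = f (loads P G w)\<close> using assms \<open>0 < \<eta>\<close> by (intro objective_approx)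
  \<comment> \<open>Here the roles of \<open>w\<close> and \<open>w'\<close> are exchanged, by
    symmetry of the approximation.\<close>
  moreover have "f (loads P G w') \<le> \<eta> * \<gamma>"
    unfolding \<open>\<gamma> = f (loads P G w)\<close>
    using assms \<open>0 < \<eta>\<close> by (intro objective_approx approximate_to_sym[of w w'])
  ultimately show ?thesis
    using \<open>0 < \<eta>\<close> by (simp add: field_simps)
qed

end
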